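(* Let $1 \leq t \leq r$ and let $\mathcal{A}$ be a $t$-intersecting subfamily of a $(\leq r)$-family $\mathcal{F}$ with $l(\mathcal{F},t) \geq c(r,r,t)\, l(\mathcal{F},t+1)$. Then $|\mathcal{A}| \leq l(\mathcal{F},t)$, and equality holds if and only if $\mathcal{A} \in {\rm L}(\mathcal{F},t)$.
   Context: All sets and families are finite. A set $A$ $t$-intersects $B$ if $|A\cap B|\geq t$; a family is $t$-intersecting if every two of its sets $t$-intersect. For a family $\mathcal{F}$ and a set $T$, $\mathcal{F}(T)=\{F\in\mathcal{F}: T\subseteq F\}$, a $t$-star if $|T|=t$. $l(\mathcal{F},t)$ is the size of a largest $t$-star of $\mathcal{F}$ and ${\rm L}(\mathcal{F},t)$ is the set of largest $t$-stars of $\mathcal{F}$. A $(\leq r)$-family is a family each of whose sets has at most $r$ elements. For $t\leq r$, $c(r,r,t)=r\binom{r}{t}+1$. *)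

theory Defs
  imports Main "HOL-Library.Infinite_Typeclass"
begin

text \<open>
  In untyped set theory there are sets of every finite size. The theorem is therefore stated over
  an element type of class \<open>infinite\<close>: for every \<open>t\<close> there is then a set \<open>T\<close> of size \<open>t\<close>, so a
  family always has \<open>t\<close>-stars (the empty star counts, when \<open>T\<close> lies in no member of the family).
\<close>

definition t_intersects :: "nat \<Rightarrow> 'a set \<Rightarrow> 'a set \<Rightarrow> bool" where
  "t_intersects t A B \<longleftrightarrow> t \<le> card (A \<inter> B)"

text \<open>
  The two sets need not be distinct, so all members have at least \<open>t\<close> elements.
\<close>
definition t_intersecting :: "nat \<Rightarrow> 'a set set \<Rightarrow> bool" where
  "t_intersecting t \<A> \<longleftrightarrow> (\<forall>A\<in>\<A>. \<forall>B\<in>\<A>. t_intersects t A B)"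

definition star :: "'a set set \<Rightarrow> 'a set \<Rightarrow> 'a set set" where
  "star \<F> T = {F \<in> \<F>. T \<subseteq> F}"

definition t_stars :: "'a set set \<Rightarrow> nat \<Rightarrow> 'a set set set" where
  "t_stars \<F> t = {star \<F> T | T. finite T \<and> card T = t}"

definition largest_star_size :: "'a set set \<Rightarrow> nat \<Rightarrow> nat" where
  "largest_star_size \<F> t = Max (card ` t_stars \<F> t)"

definition largest_t_stars :: "'a set set \<Rightarrow> nat \<Rightarrow> 'a set set set" where
  "largest_t_stars \<F> t = {\<S> \<in> t_stars \<F> t. card \<S> = largest_star_size \<F> t}"

definition le_family :: "nat \<Rightarrow> 'a set set \<Rightarrow> bool" where
  "le_family r \<F> \<longleftrightarrow> (\<forall>F\<in>\<F>. finite F \<and> card F \<le> r)"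

text \<open>
  The number $c(r,r,t)$.
\<close>
definition c_rr :: "nat \<Rightarrow> nat \<Rightarrow> nat" where
  "c_rr r t = r * (r choose t) + 1"

end

theory Submission imports Defs begin

text \<open>
  Suppose \<open>\<A>\<close> lies in no \<open>t\<close>-star and fix \<open>A \<in> \<A>\<close>. Every \<open>C \<in> \<A>\<close> contains a \<open>t\<close>-subset \<open>T\<close> of
  \<open>A\<close>. Some \<open>B \<in> \<A>\<close> does not contain \<open>T\<close>, and \<open>C\<close> meets \<open>B\<close> in at least \<open>t\<close> points, so \<open>C\<close> contains
  \<open>T \<union> {x}\<close> for some \<open>x \<in> B - T\<close>. Hence at most $r \binom{r}{t}$ of the \<open>(t+1)\<close>-stars cover \<open>\<A>\<close>.
\<close>

lemma finite_star: "finite \<F> \<Longrightarrow> finite (star \<F> T)"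
  by (simp add: star_def)

lemma card_star_le_largest:
  assumes "finite \<F>" "finite T" "card T = t"
  shows "card (star \<F> T) \<le> largest_star_size \<F> t"
proof -
  \<comment> \<open>\<open>T\<close> may range over infinitely many sets, but every star is a
    subfamily of \<open>\<F>\<close>, so \<open>Max\<close> is taken over a finite set.\<close>
  have "t_stars \<F> t \<subseteq> Pow \<F>"
    by (auto simp: t_stars_def star_def)
  then have "finite (t_stars \<F> t)"
    using assms(1) by (meson finite_Pow_iff finite_subset)
  then show ?thesis
    using assms(2,3) unfolding largest_star_size_def
    by (intro Max_ge) (auto simp: t_stars_def)
qed

text \<open>Otherwise \<open>C \<inter> B\<close> would be a subset of \<open>T\<close> with at
  least \<open>card T\<close> elements, hence \<open>T\<close> itself, putting \<open>T\<close>
  inside \<open>B\<close>.\<close>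

lemma t_intersects_extend:
  assumes "t_intersects t C B" "finite T" "card T = t" "\<not> T \<subseteq> B"
  shows "\<exists>x\<in>B - T. x \<in> C"
proof (rule ccontr)
  assume "\<not> ?thesis"
  then have sub: "C \<inter> B \<subseteq> T"
    by blast
  moreover have "card T \<le> card (C \<inter> B)"
    using assms(1,3) by (simp add: t_intersects_def)
  ultimately have "C \<inter> B = T"
    using assms(2) by (simp add: card_seteq)
  then show False
    using assms(4) by blast
qed

lemma card_nontrivial_t_intersecting_le:
  assumes fin: "finite \<F>" and le: "le_family r \<F>"
    and sub: "\<A> \<subseteq> \<F>" and int: "t_intersecting t \<A>" and "\<A> \<noteq> {}"
    and nontriv: "\<And>T. finite T \<Longrightarrow> card T = t \<Longrightarrow> \<not> \<A> \<subseteq> star \<F> T"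
  shows "card \<A> \<le> r * (r choose t) * largest_star_size \<F> (t + 1)"
proof -
  let ?l = "largest_star_size \<F> (t + 1)"
  obtain A where A: "A \<in> \<A>"
    using \<open>\<A> \<noteq> {}\<close> by blast
  have bnd: "finite B \<and> card B \<le> r" if "B \<in> \<A>" for B
    using le sub that unfolding le_family_def by blast
  define \<T> where "\<T> = {T. T \<subseteq> A \<and> card T = t}"
  have finA: "finite A"
    using bnd[OF A] by blast
  have fin\<T>: "finite \<T>"
    using finA by (simp add: \<T>_def)
  have "card \<T> = card A choose t"
    unfolding \<T>_def using n_subsets[OF finA] .
  then have card\<T>: "card \<T> \<le> r choose t"
    using bnd[OF A] by (simp add: binomial_right_mono)
  have T: "finite T \<and> card T = t" if "T \<in> \<T>" for T
    using that finA finite_subset by (auto simp: \<T>_def)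
  have "\<forall>T\<in>\<T>. \<exists>B\<in>\<A>. \<not> T \<subseteq> B"
    using T nontriv sub by (fastforce simp: star_def)
  then obtain B where B: "\<And>T. T \<in> \<T> \<Longrightarrow> B T \<in> \<A> \<and> \<not> T \<subseteq> B T"
    by metis
  let ?S = "\<lambda>T. \<Union>x\<in>B T - T. star \<F> (insert x T)"
  have cover: "\<A> \<subseteq> (\<Union>T\<in>\<T>. ?S T)"
  proof
    fix C assume C: "C \<in> \<A>"
    \<comment> \<open>This covers \<open>C = A\<close> too, since \<open>t_intersecting\<close> also
      compares a set with itself.\<close>
    have "t \<le> card (C \<inter> A)"
      using int C A by (simp add: t_intersecting_def t_intersects_def)
    then obtain T where T': "T \<subseteq> C \<inter> A" "card T = t"
      using obtain_subset_with_card_n by metis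
    then have T\<T>: "T \<in> \<T>"
      by (simp add: \<T>_def)
    have "t_intersects t C (B T)"
      using int C B[OF T\<T>] by (simp add: t_intersecting_def)
    then obtain x where "x \<in> B T - T" "x \<in> C"
      using t_intersects_extend T[OF T\<T>] B[OF T\<T>] by blast
    then have "C \<in> ?S T"
      using C sub T' by (auto simp: star_def)
    then show "C \<in> (\<Union>T\<in>\<T>. ?S T)"
      using T\<T> by blast
  qed
  have S: "card (?S T) \<le> r * ?l" if "T \<in> \<T>" for T
  proof -
    have BT: "finite (B T)" "card (B T) \<le> r"
      using bnd B[OF that] by blast+
    have "card (?S T) \<le> (\<Sum>x\<in>B T - T. card (star \<F> (insert x T)))"
      using BT by (intro card_UN_le) simp
    \<comment> \<open>As \<open>x\<close> lies outside \<open>T\<close>, \<open>insert x T\<close>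
      has exactly \<open>t + 1\<close> elements.\<close>
    also have "\<dots> \<le> of_nat (card (B T - T)) * ?l"
      using T[OF that] by (intro sum_bounded_above card_star_le_largest[OF fin]) auto
    also have "\<dots> \<le> r * ?l"
      using BT card_mono[of "B T" "B T - T"] by (intro mult_right_mono) auto
    finally show ?thesis .
  qed
  have "(\<Union>T\<in>\<T>. ?S T) \<subseteq> \<F>"
    by (auto simp: star_def)
  then have "card \<A> \<le> card (\<Union>T\<in>\<T>. ?S T)"
    using cover fin by (meson card_mono finite_subset)
  also have "\<dots> \<le> (\<Sum>T\<in>\<T>. card (?S T))"
    by (rule card_UN_le[OF fin\<T>])
  also have "\<dots> \<le> of_nat (card \<T>) * (r * ?l)"
    by (rule sum_bounded_above[OF S])
  also have "\<dots> \<le> (r choose t) * (r * ?l)"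
    using card\<T> by (intro mult_right_mono) auto
  finally show ?thesis
    by (simp add: ac_simps)
qed

theorem theorem1p4:
  fixes \<F> \<A> :: "'a::infinite set set" and r t :: nat
  assumes "1 \<le> t" and "t \<le> r"
    and "finite \<F>" and "le_family r \<F>"
    and "\<A> \<subseteq> \<F>" and "t_intersecting t \<A>"
    and "largest_star_size \<F> t \<ge> c_rr r t * largest_star_size \<F> (t + 1)"
  shows "card \<A> \<le> largest_star_size \<F> t \<and>
         (card \<A> = largest_star_size \<F> t \<longleftrightarrow> \<A> \<in> largest_t_stars \<F> t)"
proof (cases "\<exists>T. finite T \<and> card T = t \<and> \<A> \<subseteq> star \<F> T")
  case True
  then obtain T where T: "finite T" "card T = t" "\<A> \<subseteq> star \<F> T"
    by blast
  have fin: "finite (star \<F> T)"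
    using assms(3) by (rule finite_star)
  have le: "card (star \<F> T) \<le> largest_star_size \<F> t"
    using assms(3) T by (simp add: card_star_le_largest)
  have "\<A> \<in> largest_t_stars \<F> t" if "card \<A> = largest_star_size \<F> t"
  proof -
    \<comment> \<open>The star has at most \<open>largest_star_size \<F> t\<close> members and
      \<open>\<A>\<close> already supplies that many of them.\<close>
    have "\<A> = star \<F> T"
      using card_seteq[OF fin T(3)] le that by simp
    then show ?thesis
      using T that by (auto simp: largest_t_stars_def t_stars_def)
  qed
  then show ?thesis
    using le card_mono[OF fin T(3)] by (auto simp: largest_t_stars_def)
next
  case False
  \<comment> \<open>The empty family lies in every \<open>t\<close>-star, and an infinite type
    provides a \<open>T\<close> of size \<open>t\<close>, so it falls under the first case.\<close>
  have "\<A> \<noteq> {}"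
  proof -
    obtain T :: "'a set" where "finite T" "card T = t"
      using infinite_arbitrarily_large[OF infinite_UNIV] by blast
    then show ?thesis
      using False by blast
  qed
  then have pos: "card \<A> > 0"
    using assms(3,5) by (meson card_gt_0_iff finite_subset)
  have le: "card \<A> \<le> r * (r choose t) * largest_star_size \<F> (t + 1)"
    using card_nontrivial_t_intersecting_le[OF assms(3-6) \<open>\<A> \<noteq> {}\<close>] False by blast
  \<comment> \<open>A zero here would force \<open>\<A>\<close> to be empty. Positivity lets the
    \<open>+ 1\<close> in \<open>c_rr\<close> make the next inequality strict.\<close>
  with pos have "largest_star_size \<F> (t + 1) > 0"
    by (metis gr0I le_zero_eq less_numeral_extra(3) mult_0_right)
  with le have "card \<A> < c_rr r t * largest_star_size \<F> (t + 1)"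
    by (simp add: c_rr_def)
  with assms(7) have "card \<A> < largest_star_size \<F> t"
    by simp
  \<comment> \<open>By strictness, both sides of the equivalence are false.\<close>
  then show ?thesis
    by (auto simp: largest_t_stars_def)
qed

end
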